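(* Let $m,n\ge 2$ be integers. The $2$-capture time of the $m\times n$ grid (the Cartesian product $P_m\square P_n$ of a path with $m$ vertices and a path with $n$ vertices) is equal to $$\left\lfloor \frac{m+n}{2}\right\rfloor - 1 .$$
   Context: The Cartesian product $G\square H$ has vertex set $V(G)\times V(H)$, with $(u_1,v_1)$ and $(u_2,v_2)$ adjacent iff either $u_1=u_2$ and $v_1v_2\in E(H)$, or $v_1=v_2$ and $u_1u_2\in E(G)$. Cops and Robber game with $k$ cops on a finite simple connected graph $G$: players occupy vertices, and several players may occupy the same vertex. In round 0, first each of the $k$ cops chooses a starting vertex, then the robber chooses a starting vertex. In each subsequent round $1,2,\dots$, first each cop moves and then the robber moves; a move of a player consists of staying or going to an adjacent vertex. All positions are known to all players at all times. The game ends and the cops win (the robber is captured) as soon as the robber is at a vertex occupied by some cop. (Letting the robber move before the cops in each round after round 0 does not change the values below, and the paper adopts that convention.) The length of a game is $t$ if the robber is captured in round $t$, and infinite if she is never captured. The $k$-capture time $\operatorname{capt}_k(G)$ is the length of an optimal game: the least $t$ such that $k$ cops have a strategy (including the choice of starting vertices) guaranteeing capture in round at most $t$, whatever the robber does (infinite if there is no such $t$). *)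

theory Defs
  imports "Graph_Theory.Pair_Digraph" "HOL-Library.Extended_Nat"
begin

text \<open>
  An undirected graph is a \<^typ>\<open>'a pair_pre_digraph\<close> whose arc set is symmetric and irreflexive
  (\<^locale>\<open>pair_graph\<close>): an edge \<open>uv\<close> is the pair of arcs \<open>(u, v)\<close>, \<open>(v, u)\<close>.
\<close>

definition path_graph :: "nat \<Rightarrow> nat pair_pre_digraph" where
  "path_graph n =
    \<lparr>pverts = {..<n}, parcs = {(i, j). i < n \<and> j < n \<and> (j = Suc i \<or> i = Suc j)}\<rparr>"

definition cartesian_product ::
  "'a pair_pre_digraph \<Rightarrow> 'b pair_pre_digraph \<Rightarrow> ('a \<times> 'b) pair_pre_digraph" where
  "cartesian_product G H =
    \<lparr>pverts = pverts G \<times> pverts H,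
     parcs = {((u1, v1), (u2, v2)).
       (u1 = u2 \<and> u1 \<in> pverts G \<and> (v1, v2) \<in> parcs H) \<or>
       (v1 = v2 \<and> v1 \<in> pverts H \<and> (u1, u2) \<in> parcs G)}\<rparr>"

definition legal_move :: "'a pair_pre_digraph \<Rightarrow> 'a \<Rightarrow> 'a \<Rightarrow> bool" where
  "legal_move G u v \<longleftrightarrow> v = u \<or> (u, v) \<in> parcs G"

text \<open>
  \<open>r i\<close> is the vertex of the robber at the end of round \<open>i\<close>. Walks are infinite; what happens
  after a capture is irrelevant (a captured robber can be thought of as staying put).
\<close>

definition robber_walk :: "'a pair_pre_digraph \<Rightarrow> (nat \<Rightarrow> 'a) \<Rightarrow> bool" where
  "robber_walk G r \<longleftrightarrow> r 0 \<in> pverts G \<and> (\<forall>i. legal_move G (r i) (r (Suc i)))"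

text \<open>
  A strategy \<open>s\<close> of the cops maps the past positions \<open>[r 0, \<dots>, r (i - 1)]\<close> of the robber to the
  list of positions that the cops take in round \<open>i\<close> (in particular \<open>s []\<close> is their initial
  placement). This is a full-information strategy: the earlier positions of the cops
  are themselves determined by \<open>s\<close> and the past positions of the robber. For the same reason,
  quantifying over all robber walks covers every (adaptive) behaviour of the robber.
\<close>

definition cops_at :: "('a list \<Rightarrow> 'a list) \<Rightarrow> (nat \<Rightarrow> 'a) \<Rightarrow> nat \<Rightarrow> 'a list" where
  "cops_at s r i = s (map r [0..<i])"

definition cop_strategy :: "nat \<Rightarrow> 'a pair_pre_digraph \<Rightarrow> ('a list \<Rightarrow> 'a list) \<Rightarrow> bool" where
  "cop_strategy k G s \<longleftrightarrow>
    length (s []) = k \<and> set (s []) \<subseteq> pverts G \<and>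
    (\<forall>r i. robber_walk G r \<longrightarrow>
      list_all2 (legal_move G) (cops_at s r i) (cops_at s r (Suc i)))"

text \<open>
  In round \<open>Suc i\<close> the robber can be caught by the move of the cops, while she is still at \<open>r i\<close>,
  or by her own move to \<open>r (Suc i)\<close>.
\<close>

fun captured_in_round :: "('a list \<Rightarrow> 'a list) \<Rightarrow> (nat \<Rightarrow> 'a) \<Rightarrow> nat \<Rightarrow> bool" where
  "captured_in_round s r 0 \<longleftrightarrow> r 0 \<in> set (cops_at s r 0)"
| "captured_in_round s r (Suc i) \<longleftrightarrow>
    r i \<in> set (cops_at s r (Suc i)) \<or> r (Suc i) \<in> set (cops_at s r (Suc i))"

definition cops_win_within :: "nat \<Rightarrow> 'a pair_pre_digraph \<Rightarrow> nat \<Rightarrow> bool" where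
  "cops_win_within k G t \<longleftrightarrow>
    (\<exists>s. cop_strategy k G s \<and>
      (\<forall>r. robber_walk G r \<longrightarrow> (\<exists>i\<le>t. captured_in_round s r i)))"

text \<open>The infimum is the least such \<open>t\<close> if there is one, and \<open>\<infinity>\<close> otherwise.\<close>

definition capture_time :: "nat \<Rightarrow> 'a pair_pre_digraph \<Rightarrow> enat" where
  "capture_time k G = (INF t\<in>{t. cops_win_within k G t}. enat t)"

end

theory Submission
  imports Defs
begin

text \<open>
  Let \<open>T = (m + n) div 2 - 1\<close>. Upper bound: two cops start on adjacent central vertices, and each
  cop always decreases the larger of its two coordinate distances to the robber. Until a cop is
  next to the robber, each of its steps brings it closer to a wall that the robber cannot leave
  behind, so after \<open>T\<close> rounds both cops are within distance 1 of the robber. As both cops step in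
  every round, they always stand on vertices of opposite parity, so one of them is on the robber.

  Lower bound: the distances of a cop to the corners \<open>(0, 0)\<close> and \<open>(m - 1, n - 1)\<close> add up to
  \<open>m + n - 2\<close>. If some cop is at distance at least \<open>T + 2\<close> from one of these corners, the robber
  runs around the 4-cycle at that corner, where one cop alone never catches her. Otherwise either
  both cops are at distance at least \<open>T\<close> from one of them, where she just waits, or the distances
  of the two cops to the corner \<open>(0, 0)\<close> are \<open>T - 1\<close> and \<open>T + 1\<close>; then she waits there and
  steps aside once at the end.
\<close>

section \<open>Distance and parity in the grid\<close>

abbreviation grid :: "nat \<Rightarrow> nat \<Rightarrow> (nat \<times> nat) pair_pre_digraph" where
  "grid m n \<equiv> cartesian_product (path_graph m) (path_graph n)"

fun grid_dist :: "nat \<times> nat \<Rightarrow> nat \<times> nat \<Rightarrow> int" where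
  "grid_dist (a, b) (x, y) = \<bar>int x - int a\<bar> + \<bar>int y - int b\<bar>"

lemma pverts_grid: "pverts (grid m n) = {..<m} \<times> {..<n}"
  by (simp add: cartesian_product_def path_graph_def)

lemma legal_move_grid:
  "legal_move (grid m n) u v \<longleftrightarrow>
     v = u \<or> u \<in> {..<m} \<times> {..<n} \<and> v \<in> {..<m} \<times> {..<n} \<and> grid_dist u v = 1"
  by (cases u; cases v) (auto simp: legal_move_def cartesian_product_def path_graph_def)

lemma grid_dist_legal_move:
  assumes "legal_move (grid m n) u v"
  shows "grid_dist v w \<ge> grid_dist u w - 1"
  using assms by (cases u; cases v; cases w) (auto simp: legal_move_grid)

lemma grid_dist_self: "grid_dist u u = 0"
  by (cases u) auto

lemma grid_neighbour_parity:
  assumes "grid_dist u v \<le> 1" "u \<noteq> v"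
  shows "even (fst u + snd u) \<longleftrightarrow> odd (fst v + snd v)"
proof -
  obtain a b x y where eqs: "u = (a, b)" "v = (x, y)" by (cases u; cases v) auto
  then have "x = a \<and> (y = Suc b \<or> b = Suc y) \<or> y = b \<and> (x = Suc a \<or> a = Suc x)"
    using assms by auto
  then show ?thesis using eqs by auto
qed

lemma robber_walk_in_grid:
  assumes "robber_walk (grid m n) r"
  shows "r i \<in> {..<m} \<times> {..<n}"
proof (induction i)
  case 0
  then show ?case using assms by (simp add: robber_walk_def pverts_grid)
next
  case (Suc i)
  then show ?case using assms by (metis robber_walk_def legal_move_grid)
qed


section \<open>Two cops starting at the centre\<close>

fun toward :: "nat \<Rightarrow> nat \<Rightarrow> nat" where
  "toward a x = (if a < x then Suc a else if x < a then a - 1 else a)"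

fun chase :: "nat \<times> nat \<Rightarrow> nat \<times> nat \<Rightarrow> nat \<times> nat" where
  "chase (x, y) (a, b) =
    (if \<bar>int y - int b\<bar> \<le> \<bar>int x - int a\<bar> then (toward a x, b) else (a, toward b y))"

lemma chase_legal:
  assumes "c \<in> {..<m} \<times> {..<n}" "r \<in> {..<m} \<times> {..<n}"
  shows "legal_move (grid m n) c (chase r c)"
  using assms by (cases c; cases r) (auto simp: legal_move_grid)

lemma chase_in_grid:
  assumes "c \<in> {..<m} \<times> {..<n}" "r \<in> {..<m} \<times> {..<n}"
  shows "chase r c \<in> {..<m} \<times> {..<n}"
  using assms by (cases c; cases r) auto

text \<open>Off the robber, the larger coordinate distance is positive, so \<open>chase\<close>
  takes a real step and changes colour in the bipartition.\<close>

lemma chase_parity: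
  assumes "c \<noteq> r"
  shows "even (fst (chase r c) + snd (chase r c)) \<longleftrightarrow> odd (fst c + snd c)"
  using assms by (cases c; cases r) auto

text \<open>
  The distance from a cop at \<open>a\<close> to the end of the path \<open>{0..M - 1}\<close> on the robber's side, and to
  the farther end if the robber at \<open>x = a\<close> can still choose a side.
\<close>

definition gap :: "int \<Rightarrow> int \<Rightarrow> int \<Rightarrow> int" where
  "gap M a x = (if a < x then M - 1 - a else if x < a then a else max a (M - 1 - a))"

text \<open>
  The bound \<open>k\<close> drops in every round (\<open>tracked_int_step\<close>). While \<open>p \<ge> q + 2\<close> the cop only moves
  in the first coordinate, so the robber may change sides in the second one: there the bound
  counts the farther wall. In the balanced case \<open>\<bar>p - q\<bar> \<le> 1\<close> she cannot change sides in either
  coordinate before the cop is next to her.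
\<close>

definition tracked_int :: "int \<Rightarrow> int \<Rightarrow> int \<Rightarrow> int \<Rightarrow> int \<Rightarrow> int \<Rightarrow> int \<Rightarrow> bool" where
  "tracked_int m n k a b x y \<longleftrightarrow>
    (let p = \<bar>x - a\<bar>; q = \<bar>y - b\<bar> in
      p + q \<le> 1 \<or>
      p \<ge> 1 \<and> q \<ge> 1 \<and> \<bar>p - q\<bar> \<le> 1 \<and> gap m a x + gap n b y \<le> k \<or>
      p \<ge> q + 2 \<and> gap m a x + gap n b b \<le> k \<or>
      q \<ge> p + 2 \<and> gap m a a + gap n b y \<le> k)"

fun tracked :: "nat \<Rightarrow> nat \<Rightarrow> int \<Rightarrow> nat \<times> nat \<Rightarrow> nat \<times> nat \<Rightarrow> bool" where
  "tracked m n k (a, b) (x, y) \<longleftrightarrow> tracked_int (int m) (int n) k (int a) (int b) (int x) (int y)"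

lemma tracked_int_swap: "tracked_int m n k a b x y \<longleftrightarrow> tracked_int n m k b a y x"
  unfolding tracked_int_def Let_def by (auto simp: add.commute abs_minus_commute)

text \<open>The robber moves first, and the last hypothesis says that \<open>chase\<close> then
  answers in the first coordinate; the other case follows by
  \<open>tracked_int_swap\<close>.\<close>

lemma tracked_int_step:
  assumes "x' = x \<and> \<bar>y' - y\<bar> \<le> 1 \<or> y' = y \<and> \<bar>x' - x\<bar> \<le> 1"
    and "tracked_int m n k a b x y" and "\<bar>y' - b\<bar> \<le> \<bar>x' - a\<bar>"
  shows "tracked_int m n (k - 1) (a + sgn (x' - a)) b x' y'"
proof (cases x' a rule: linorder_cases)
  case less
  have "tracked_int m n (k - 1) (a - 1) b x' y'"
    using assms less unfolding tracked_int_def Let_def gap_def by (smt (verit))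
  then show ?thesis using less by simp
next
  case equal
  then show ?thesis using assms(3) by (simp add: tracked_int_def)
next
  case greater
  have "tracked_int m n (k - 1) (a + 1) b x' y'"
    using assms greater unfolding tracked_int_def Let_def gap_def by (smt (verit))
  then show ?thesis using greater by simp
qed

text \<open>\<open>gap\<close> at the cop's own coordinate is its eccentricity in the path, which
  bounds \<open>gap\<close> for either side the robber may choose.\<close>

lemma tracked_initial:
  assumes "gap m a a + gap n b b \<le> k"
  shows "tracked m n k (a, b) (x, y)"
  using assms by (simp add: tracked_int_def gap_def Let_def) (smt (verit))

lemma int_toward: "int (toward a x) = int a + sgn (int x - int a)"
  by auto

lemma tracked_chase:
  assumes "tracked m n k c r" and "legal_move (grid m n) r r'"
  shows "tracked m n (k - 1) (chase r' c) r'"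
proof -
  obtain a b x y x' y' where eqs: "c = (a, b)" "r = (x, y)" "r' = (x', y')"
    by (cases c; cases r; cases r') auto
  have mv: "int x' = int x \<and> \<bar>int y' - int y\<bar> \<le> 1 \<or> int y' = int y \<and> \<bar>int x' - int x\<bar> \<le> 1"
    using assms(2) by (auto simp: legal_move_grid eqs)
  then have mv': "int y' = int y \<and> \<bar>int x' - int x\<bar> \<le> 1 \<or> int x' = int x \<and> \<bar>int y' - int y\<bar> \<le> 1"
    by blast
  have tr: "tracked_int m n k a b x y" "tracked_int n m k b a y x"
    using assms(1) eqs tracked_int_swap by auto
  show ?thesis
  proof (cases "\<bar>int y' - int b\<bar> \<le> \<bar>int x' - int a\<bar>")
    case True
    then show ?thesis
      using tracked_int_step[OF mv tr(1) True] eqs int_toward by (simp del: toward.simps)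
  next
    case False
    then have "\<bar>int x' - int a\<bar> \<le> \<bar>int y' - int b\<bar>" by simp
    from tracked_int_step[OF mv' tr(2) this] show ?thesis
      using False eqs int_toward tracked_int_swap by (simp del: toward.simps)
  qed
qed

text \<open>Inside the grid \<open>gap\<close> is at least the coordinate distance, so every
  alternative of \<open>tracked_int\<close> but the first would force a bound of at least 2.\<close>

lemma tracked_one:
  assumes "tracked m n 1 c r" "r \<in> {..<m} \<times> {..<n}"
  shows "grid_dist c r \<le> 1"
  using assms by (cases c; cases r) (auto simp: tracked_int_def gap_def Let_def split: if_splits)

lemma cops_win_within_from:
  fixes c d :: "nat \<times> nat"
  assumes c: "c \<in> {..<m} \<times> {..<n}" and d: "d \<in> {..<m} \<times> {..<n}"
    and par: "odd (fst c + snd c + (fst d + snd d))" and T: "T \<ge> 1"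
    and gap_c: "gap m (fst c) (fst c) + gap n (snd c) (snd c) \<le> int T + 1"
    and gap_d: "gap m (fst d) (fst d) + gap n (snd d) (snd d) \<le> int T + 1"
  shows "cops_win_within 2 (grid m n) T"
proof -
  define s where "s h = map (\<lambda>e. foldl (\<lambda>e v. chase v e) e h) [c, d]" for h
  define pos where "pos r e i = foldl (\<lambda>e v. chase v e) e (map r [0..<i])"
    for r :: "nat \<Rightarrow> nat \<times> nat" and e i
  have pos_0: "pos r e 0 = e" and pos_Suc: "pos r e (Suc i) = chase (r i) (pos r e i)" for r e i
    by (simp_all add: pos_def)
  have cops: "cops_at s r i = [pos r c i, pos r d i]" for r i
    by (simp add: cops_at_def s_def pos_def)
  have pos_in: "pos r e i \<in> {..<m} \<times> {..<n}"
    if "robber_walk (grid m n) r" "e \<in> {..<m} \<times> {..<n}" for r e i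
  proof (induction i)
    case (Suc i)
    then show ?case
      using chase_in_grid robber_walk_in_grid that(1) by (simp only: pos_Suc)
  qed (use that pos_0 in simp)
  have "cop_strategy 2 (grid m n) s"
    unfolding cop_strategy_def
    using c d chase_legal[OF pos_in robber_walk_in_grid]
    by (auto simp: s_def pverts_grid cops pos_Suc)
  moreover have "\<exists>i\<le>T. captured_in_round s r i" if r: "robber_walk (grid m n) r" for r
  proof (rule ccontr)
    assume "\<not> ?thesis"
    then have uncaught: "\<not> captured_in_round s r i" if "i \<le> T" for i using that by blast
    have tracked: "tracked m n (int T - int i) (pos r e (Suc i)) (r i)"
      if "gap m (fst e) (fst e) + gap n (snd e) (snd e) \<le> int T + 1" for e :: "nat \<times> nat" and i
    proof (induction i)
      case 0
      have "tracked m n (int T + 1) e (r 0)"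
        using that tracked_initial by (cases e; cases "r 0") simp
      \<comment> \<open>In round 1 the cops answer the initial placement, treated here as a robber
        move that stays put.\<close>
      from tracked_chase[OF this, of "r 0"] show ?case
        by (simp add: pos_0 pos_Suc legal_move_def)
    next
      case (Suc i)
      have "legal_move (grid m n) (r i) (r (Suc i))" using r by (simp add: robber_walk_def)
      from tracked_chase[OF Suc this] show ?case
        by (simp add: pos_Suc[of _ _ "Suc i"] algebra_simps)
    qed
    have parity: "i \<le> T \<Longrightarrow>
      odd (fst (pos r c i) + snd (pos r c i) + (fst (pos r d i) + snd (pos r d i)))" for i
    proof (induction i)
      case 0
      then show ?case using par by (simp add: pos_0)
    next
      case (Suc i)
      have "r i \<noteq> pos r c i" "r i \<noteq> pos r d i"
        using uncaught[of i] Suc.prems by (cases i; auto simp: cops)+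
      then show ?case using Suc chase_parity[of "pos r c i" "r i"] chase_parity[of "pos r d i" "r i"]
        by (simp add: pos_Suc)
    qed
    obtain j where j: "T = Suc j" using T by (cases T) auto
    have close: "grid_dist (pos r e T) (r j) \<le> 1"
      if "gap m (fst e) (fst e) + gap n (snd e) (snd e) \<le> int T + 1" for e :: "nat \<times> nat"
      using tracked[OF that, of j] robber_walk_in_grid[OF r] tracked_one j by simp
    \<comment> \<open>A capture in round \<open>T\<close> may happen on the cops' move, with the
      robber still at \<open>r j\<close>.\<close>
    have "r j \<noteq> pos r c T" "r j \<noteq> pos r d T"
      using uncaught[of T] by (auto simp: cops j)
    then show False
      using grid_neighbour_parity[OF close[OF gap_c]] grid_neighbour_parity[OF close[OF gap_d]]
        parity[of T] by auto
  qed
  ultimately show ?thesis unfolding cops_win_within_def by blast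
qed

text \<open>For even \<open>n\<close> both central values of the second coordinate have eccentricity
  \<open>n div 2\<close>, so shifting one cop there is free. For odd \<open>n\<close> the shift is
  in the first coordinate: free if \<open>m\<close> is even, and otherwise it costs one, which the
  even sum \<open>m + n\<close> leaves to spare.\<close>

lemma two_cops_win_on_grid:
  assumes "m \<ge> 2" and "n \<ge> 2"
  shows "cops_win_within 2 (grid m n) ((m + n) div 2 - 1)"
proof (cases "even n")
  case True
  then show ?thesis
    using assms
    by (intro cops_win_within_from[of "(m div 2, n div 2)" _ _ "(m div 2, n div 2 - 1)"])
      (auto simp: gap_def elim!: evenE)
next
  case False
  then show ?thesis
    using assms
    by (intro cops_win_within_from[of "(m div 2, n div 2)" _ _ "(m div 2 - 1, n div 2)"])
      (auto simp: gap_def elim!: oddE)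
qed


section \<open>Evading two cops\<close>

text \<open>\<open>Inv j r cs\<close> is to mean that the robber at \<open>r\<close> can survive \<open>j\<close> more rounds.\<close>

lemma robber_evades:
  assumes strat: "cop_strategy k G s" and r0: "r0 \<in> pverts G" and init: "Inv t r0 (s [])"
    and safe: "\<And>j r cs. Inv j r cs \<Longrightarrow> r \<notin> set cs"
    and step: "\<And>j r cs cs'. Inv (Suc j) r cs \<Longrightarrow> list_all2 (legal_move G) cs cs' \<Longrightarrow>
      r \<notin> set cs' \<and> (\<exists>r'. legal_move G r r' \<and> Inv j r' cs')"
  shows "\<exists>r. robber_walk G r \<and> (\<forall>i\<le>t. \<not> captured_in_round s r i)"
proof -
  define good where "good i h v \<longleftrightarrow> legal_move G (last h) v \<and> Inv (t - Suc i) v (s h)" for i h v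
  \<comment> \<open>The robber's history is built recursively, each move chosen knowing the cops'
    reply to it. The default of staying put keeps the walk legal even where no \<open>good\<close>
    move exists, for instance beyond round \<open>t\<close>.\<close>
  define h where "h = rec_nat [r0]
    (\<lambda>i h. h @ [if \<exists>v. good i h v then SOME v. good i h v else last h])"
  define r where "r i = last (h i)" for i
  have h_0: "h 0 = [r0]" by (simp add: h_def)
  have h_Suc: "h (Suc i) = h i @ [r (Suc i)]" for i by (simp add: h_def r_def)
  have h_eq: "h i = map r [0..<Suc i]" for i
  proof (induction i)
    case 0
    then show ?case by (simp add: h_0 r_def)
  next
    case (Suc i)
    then show ?case by (simp add: h_Suc)
  qed
  have r_Suc: "r (Suc i) = (if \<exists>v. good i (h i) v then SOME v. good i (h i) v else r i)" for i
    by (auto simp: h_def r_def)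
  have walk: "robber_walk G r"
    unfolding robber_walk_def
  proof (intro conjI allI)
    show "r 0 \<in> pverts G" using r0 by (simp add: r_def h_0)
    fix i
    show "legal_move G (r i) (r (Suc i))"
    proof (cases "\<exists>v. good i (h i) v")
      case True
      then have "good i (h i) (r (Suc i))" unfolding r_Suc by (simp add: someI_ex)
      then show ?thesis by (simp add: good_def r_def)
    qed (simp add: r_Suc legal_move_def)
  qed
  have cops_move: "list_all2 (legal_move G) (cops_at s r i) (cops_at s r (Suc i))" for i
    using strat walk by (simp add: cop_strategy_def)
  have inv: "i \<le> t \<Longrightarrow> Inv (t - i) (r i) (cops_at s r i)" for i
  proof (induction i)
    case 0
    then show ?case using init by (simp add: r_def h_0 cops_at_def)
  next
    case (Suc i)
    then have "Inv (Suc (t - Suc i)) (r i) (cops_at s r i)" by (simp add: Suc_diff_Suc)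
    then have "\<exists>v. legal_move G (r i) v \<and> Inv (t - Suc i) v (cops_at s r (Suc i))"
      using step cops_move by blast
    then have "\<exists>v. good i (h i) v" unfolding good_def r_def cops_at_def h_eq[symmetric] .
    then have "good i (h i) (r (Suc i))" unfolding r_Suc by (simp add: someI_ex)
    then show ?case by (simp add: good_def cops_at_def h_eq)
  qed
  have "\<not> captured_in_round s r i" if "i \<le> t" for i
  proof (cases i)
    case 0
    then show ?thesis using safe[OF inv[of 0]] by simp
  next
    case (Suc j)
    have "Inv (Suc (t - i)) (r j) (cops_at s r j)"
      using inv[of j] that Suc by (simp add: Suc_diff_Suc)
    then have "r j \<notin> set (cops_at s r i)" using step cops_move Suc by blast
    then show ?thesis using safe[OF inv[OF that]] Suc by simp
  qed
  then show ?thesis using walk by blast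
qed

text \<open>Allows the two cops to be named by role instead of by their order in the list.\<close>

lemma list_all2_pairE:
  assumes "list_all2 P cs cs'" and "cs = [u, v] \<or> cs = [v, u]"
  obtains u' v' where "P u u'" "P v v'" "cs' = [u', v'] \<or> cs' = [v', u']"
  using assms by (auto simp: list_all2_Cons1)

text \<open>A cop gains at most one unit of distance per round.\<close>

lemma evades_by_staying:
  assumes strat: "cop_strategy k (grid m n) s" and r0: "r0 \<in> {..<m} \<times> {..<n}"
    and far: "\<forall>c\<in>set (s []). grid_dist c r0 > int t"
  shows "\<exists>r. robber_walk (grid m n) r \<and> (\<forall>i\<le>t. \<not> captured_in_round s r i)"
proof (rule robber_evades[OF strat])
  let ?Inv = "\<lambda>j r cs. \<forall>c\<in>set cs. grid_dist c r > int j"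
  show "?Inv t r0 (s [])" using far .
  show "r0 \<in> pverts (grid m n)" using r0 by (simp add: pverts_grid)
  show "r \<notin> set cs" if "?Inv j r cs" for j r cs
  proof
    assume "r \<in> set cs"
    then have "grid_dist r r > int j" using that by blast
    then show False using grid_dist_self[of r] by simp
  qed
  show "r \<notin> set cs' \<and> (\<exists>r'. legal_move (grid m n) r r' \<and> ?Inv j r' cs')"
    if I: "?Inv (Suc j) r cs" and mv: "list_all2 (legal_move (grid m n)) cs cs'" for j r cs cs'
  proof -
    have *: "grid_dist c r > int j" if c: "c \<in> set cs'" for c
    proof -
      obtain i where i: "i < length cs'" "c = cs' ! i"
        using c by (auto simp: in_set_conv_nth)
      then have "legal_move (grid m n) (cs ! i) c" "cs ! i \<in> set cs"
        using mv by (simp_all add: list_all2_nthD2 list_all2_lengthD)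
      then show ?thesis
        using I grid_dist_legal_move[of m n "cs ! i" c r] by fastforce
    qed
    have "r \<notin> set cs'"
    proof
      assume "r \<in> set cs'"
      then have "grid_dist r r > int j" by (rule *)
      then show False using grid_dist_self[of r] by simp
    qed
    moreover have "legal_move (grid m n) r r" by (simp add: legal_move_def)
    ultimately show ?thesis using * by blast
  qed
qed

text \<open>Every value except \<open>X\<close> counts as \<open>X'\<close> before the swap: the
  path is folded onto one edge and the edge is then flipped.\<close>

definition opposite :: "nat \<Rightarrow> nat \<Rightarrow> nat \<Rightarrow> nat" where
  "opposite X X' x = (if x = X then X' else X)"

text \<open>The robber stays antipodal to the folded image of \<open>u\<close> on the square.
  Folding preserves legal moves, so she can always follow. The margin 2 bounds the distance from
  \<open>(X, Y)\<close> to any vertex of the square, which keeps \<open>v\<close> away.\<close>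

lemma evades_in_corner_square:
  assumes strat: "cop_strategy k (grid m n) s"
    and X: "X < m" "X' < m" "\<bar>int X' - int X\<bar> = 1" and Y: "Y < n" "Y' < n" "\<bar>int Y' - int Y\<bar> = 1"
    and cops: "s [] = [u, v] \<or> s [] = [v, u]" and far: "grid_dist v (X, Y) > int t + 2"
  shows "\<exists>r. robber_walk (grid m n) r \<and> (\<forall>i\<le>t. \<not> captured_in_round s r i)"
proof -
  \<comment> \<open>Both coordinates of \<open>opp w\<close> differ from those of \<open>w\<close>, so no single step leads from \<open>w\<close> to it.\<close>
  define opp where "opp w = (opposite X X' (fst w), opposite Y Y' (snd w))" for w
  define Inv where "Inv j r cs \<longleftrightarrow> (\<exists>u v. (cs = [u, v] \<or> cs = [v, u]) \<and>
    r = opp u \<and> grid_dist v (X, Y) > int j + 2)" for j :: nat and r cs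
  have opp_near: "grid_dist (opp w) (X, Y) \<le> 2" for w
    using X Y by (auto simp: opp_def opposite_def)
  have opp_neq: "opp w \<noteq> w'" if "legal_move (grid m n) w w'" for w w'
    using that X Y by (cases w; cases w') (auto simp: legal_move_grid opp_def opposite_def split: if_splits)
  have opp_move: "legal_move (grid m n) (opp w) (opp w')" if "legal_move (grid m n) w w'" for w w'
    using that X Y by (cases w; cases w') (auto simp: legal_move_grid opp_def opposite_def)
  show ?thesis
  proof (rule robber_evades[OF strat, of "opp u" Inv])
    show "opp u \<in> pverts (grid m n)"
      using X Y by (simp add: pverts_grid opp_def opposite_def)
    show "Inv t (opp u) (s [])" unfolding Inv_def using cops far by blast
    show "r \<notin> set cs" if I: "Inv j r cs" for j r cs
    proof -
      obtain u v where *: "cs = [u, v] \<or> cs = [v, u]" "r = opp u" "grid_dist v (X, Y) > int j + 2"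
        using I unfolding Inv_def by blast
      have "r \<noteq> u" using * opp_neq[of u u] by (simp add: legal_move_def)
      moreover have "r \<noteq> v" using * opp_near[of u] by auto
      ultimately show ?thesis using * by auto
    qed
    show "r \<notin> set cs' \<and> (\<exists>r'. legal_move (grid m n) r r' \<and> Inv j r' cs')"
      if I: "Inv (Suc j) r cs" and mv: "list_all2 (legal_move (grid m n)) cs cs'" for j r cs cs'
    proof -
      obtain u v where *: "cs = [u, v] \<or> cs = [v, u]" "r = opp u" "grid_dist v (X, Y) > int (Suc j) + 2"
        using I unfolding Inv_def by blast
      obtain u' v' where mv': "legal_move (grid m n) u u'" "legal_move (grid m n) v v'"
        and cs': "cs' = [u', v'] \<or> cs' = [v', u']"
        using list_all2_pairE[OF mv *(1)] by metis
      have far': "grid_dist v' (X, Y) > int j + 2"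
        using *(3) grid_dist_legal_move[OF mv'(2), of "(X, Y)"] by simp
      have "r \<noteq> u'" using * opp_neq mv' by simp
      moreover have "r \<noteq> v'" using * far' opp_near[of u] by auto
      moreover have "Inv j (opp u') cs'" unfolding Inv_def using cs' far' by blast
      moreover have "legal_move (grid m n) r (opp u')" using *(2) opp_move[OF mv'(1)] by simp
      moreover have "r \<notin> set cs'" using cs' calculation by auto
      ultimately show ?thesis by blast
    qed
  qed
qed

text \<open>The two neighbours of the corner are at distance 2 from each other, so if
  \<open>u\<close> occupies one, the other is safe from it; one step costs at most one of the three
  units to \<open>v\<close>.\<close>

lemma dodge_at_corner:
  assumes "m \<ge> 2" "n \<ge> 2" "grid_dist u (0, 0) \<ge> 1" "grid_dist v (0, 0) \<ge> 3"
  obtains r where "legal_move (grid m n) (0, 0) r" "grid_dist u r > 1" "grid_dist v r > 1"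
proof -
  obtain r where "r = (0, 0) \<or> r = (1, 0) \<or> r = (0, 1)" "grid_dist u r > 1"
  proof (cases "grid_dist u (0, 0) > 1")
    case False
    then have "u = (1, 0) \<or> u = (0, 1)" using assms(3) by (cases u) auto
    then show ?thesis using that[of "(0, 1)"] that[of "(1, 0)"] by auto
  qed (use that in blast)
  moreover from this have "legal_move (grid m n) (0, 0) r" "grid_dist v r > 1"
    using assms by (cases v; auto simp: legal_move_grid)+
  ultimately show ?thesis using that by blast
qed

lemma evades_at_corner:
  assumes m: "m \<ge> 2" and n: "n \<ge> 2" and strat: "cop_strategy k (grid m n) s"
    and cops: "s [] = [u, v] \<or> s [] = [v, u]"
    and near: "grid_dist u (0, 0) \<ge> int t" and far: "grid_dist v (0, 0) \<ge> int t + 2"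
  shows "\<exists>r. robber_walk (grid m n) r \<and> (\<forall>i\<le>t. \<not> captured_in_round s r i)"
proof -
  consider "t = 0" | "t = 1" | "t \<ge> 2" by linarith
  then show ?thesis
  proof cases
    case 1
    obtain r0 where r0: "r0 = (1, 0) \<or> r0 = (0, 1)" "r0 \<noteq> u"
      by (metis prod.inject zero_neq_one)
    then have "grid_dist u r0 > 0" "grid_dist v r0 > 0"
      using far 1 by (cases u; cases v; auto)+
    then show ?thesis
      using r0 m n cops 1 by (intro evades_by_staying[OF strat, of r0]) auto
  next
    case 2
    obtain r0 where r0: "legal_move (grid m n) (0, 0) r0" "grid_dist u r0 > 1" "grid_dist v r0 > 1"
      by (rule dodge_at_corner[OF m n, of u v]) (use near far 2 in auto)
    then have "r0 \<in> {..<m} \<times> {..<n}" using m n by (auto simp: legal_move_grid)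
    then show ?thesis
      using r0 cops 2 by (intro evades_by_staying[OF strat, of r0]) auto
  next
    case 3
    \<comment> \<open>The second alternative is waiting at the corner. It stops at
      \<open>j = 2\<close>, since she must step aside before \<open>u\<close> can reach her.\<close>
    define Inv where "Inv j r cs \<longleftrightarrow> (\<exists>u v. (cs = [u, v] \<or> cs = [v, u]) \<and>
      (grid_dist u r > int j \<and> grid_dist v r > int j \<or>
       r = (0, 0) \<and> j \<ge> 2 \<and> grid_dist u r \<ge> int j \<and> grid_dist v r \<ge> int j + 2))"
      for j :: nat and r cs
    show ?thesis
    proof (rule robber_evades[OF strat, of "(0, 0)" Inv])
      show "(0, 0) \<in> pverts (grid m n)" using m n by (simp add: pverts_grid)
      show "Inv t (0, 0) (s [])" unfolding Inv_def using cops near far 3 by blast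
      show "r \<notin> set cs" if I: "Inv j r cs" for j r cs
      proof -
        obtain u v where "cs = [u, v] \<or> cs = [v, u]" "grid_dist u r > 0" "grid_dist v r > 0"
          using I unfolding Inv_def by fastforce
        then show ?thesis using grid_dist_self[of r] by auto
      qed
      show "r \<notin> set cs' \<and> (\<exists>r'. legal_move (grid m n) r r' \<and> Inv j r' cs')"
        if I: "Inv (Suc j) r cs" and mv: "list_all2 (legal_move (grid m n)) cs cs'" for j r cs cs'
      proof -
        obtain u v where cs: "cs = [u, v] \<or> cs = [v, u]" and
          pos: "grid_dist u r > int j + 1 \<and> grid_dist v r > int j + 1 \<or>
            r = (0, 0) \<and> j \<ge> 1 \<and> grid_dist u r \<ge> int j + 1 \<and> grid_dist v r \<ge> int j + 3"
          using I by (fastforce simp: Inv_def)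
        obtain u' v' where mv': "legal_move (grid m n) u u'" "legal_move (grid m n) v v'"
          and cs': "cs' = [u', v'] \<or> cs' = [v', u']"
          using list_all2_pairE[OF mv cs] by metis
        have pos': "grid_dist u' r > int j \<and> grid_dist v' r > int j \<or>
            r = (0, 0) \<and> j \<ge> 1 \<and> grid_dist u' r \<ge> int j \<and> grid_dist v' r \<ge> int j + 2"
          using pos grid_dist_legal_move[OF mv'(1), of r] grid_dist_legal_move[OF mv'(2), of r]
          by auto
        then have "r \<noteq> u'" "r \<noteq> v'" using grid_dist_self[of r] by auto
        then have safe: "r \<notin> set cs'" using cs' by auto
        have InvI: "Inv j r' cs'" if "grid_dist u' r' > int j" "grid_dist v' r' > int j" for r'
          using that cs' unfolding Inv_def by blast
        have "\<exists>r'. legal_move (grid m n) r r' \<and> Inv j r' cs'"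
        proof (cases "grid_dist u' r > int j \<and> grid_dist v' r > int j")
          case True
          then have "Inv j r cs'" using InvI by blast
          then show ?thesis by (meson legal_move_def)
        next
          case False
          with pos' have corner: "r = (0, 0)" "j \<ge> 1" "grid_dist u' r \<ge> int j" "grid_dist v' r \<ge> int j + 2"
            by auto
          show ?thesis
          proof (cases "j = 1")
            case True
            \<comment> \<open>With one round left after this move, the cops are at distances at
              least 1 and 3, and the dodge restores the strict bound for both.\<close>
            then obtain r' where "legal_move (grid m n) (0, 0) r'" "grid_dist u' r' > 1" "grid_dist v' r' > 1"
              using corner by (auto intro: dodge_at_corner[OF m n, of u' v'])
            moreover from this have "Inv j r' cs'" using InvI True by simp
            ultimately show ?thesis using corner(1) by blast
          next
            case False
            then have "j \<ge> 2" using corner(2) by simp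
            then have "Inv j r cs'" using corner cs' unfolding Inv_def by blast
            then show ?thesis by (meson legal_move_def)
          qed
        qed
        with safe show ?thesis by blast
      qed
    qed
  qed
qed

section \<open>Choosing the robber's plan from the cops' starting vertices\<close>

lemma robber_evades_two_cops:
  assumes m: "m \<ge> 2" and n: "n \<ge> 2" and strat: "cop_strategy 2 (grid m n) s"
  shows "\<exists>r. robber_walk (grid m n) r \<and> (\<forall>i\<le>(m + n) div 2 - 2. \<not> captured_in_round s r i)"
proof -
  define t where "t = (m + n) div 2 - 2"
  define C where "C = (m - 1, n - 1)"
  obtain c d where cops: "s [] = [c, d]"
    using strat by (auto simp: cop_strategy_def numeral_2_eq_2 length_Suc_conv)
  have in_grid: "c \<in> {..<m} \<times> {..<n}" "d \<in> {..<m} \<times> {..<n}"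
    using strat cops by (auto simp: cop_strategy_def pverts_grid)
  have sum: "grid_dist e (0, 0) + grid_dist e C = int m + int n - 2" if "e \<in> {..<m} \<times> {..<n}" for e
    using that by (cases e) (auto simp: C_def)
  have t: "2 * int t + 4 \<le> int m + int n" "int m + int n \<le> 2 * int t + 5"
    using m n by (auto simp: t_def)
  have stay: ?thesis if "P \<in> {(0, 0), C}" "grid_dist c P > int t" "grid_dist d P > int t" for P
    using evades_by_staying[OF strat, of P t] that cops m n by (auto simp: C_def t_def)
  have square_0: ?thesis
    if "s [] = [u, v] \<or> s [] = [v, u]" "grid_dist v (0, 0) > int t + 2" for u v
    using evades_in_corner_square[OF strat, of 0 1 0 1 u v t] that m n by (simp add: t_def)
  have square_C: ?thesis
    if "s [] = [u, v] \<or> s [] = [v, u]" "grid_dist v C > int t + 2" for u v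
    using evades_in_corner_square[OF strat, of "m - 1" "m - 2" "n - 1" "n - 2" u v t] that m n
    by (simp add: t_def C_def)
  have corner: ?thesis
    if "s [] = [u, v] \<or> s [] = [v, u]" "grid_dist u (0, 0) \<ge> int t" "grid_dist v (0, 0) \<ge> int t + 2"
    for u v
    using evades_at_corner[OF m n strat that] by (simp add: t_def)
  show ?thesis
  proof (cases "grid_dist c (0, 0) > int t + 2 \<or> grid_dist d (0, 0) > int t + 2 \<or>
      grid_dist c C > int t + 2 \<or> grid_dist d C > int t + 2")
    case True
    then show ?thesis
      using square_0[of c d] square_0[of d c] square_C[of c d] square_C[of d c] cops by blast
  next
    case False
    \<comment> \<open>The two corner distances of a cop sum to \<open>2 * t + 2\<close> or
      \<open>2 * t + 3\<close>, and each is at most \<open>t + 2\<close>. So each is at least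
      \<open>t\<close>, and staying fails at both corners only for distances \<open>t\<close> and
      \<open>t + 2\<close> from \<open>(0, 0)\<close>.\<close>
    then have "grid_dist c (0, 0) > int t \<and> grid_dist d (0, 0) > int t \<or>
      grid_dist c C > int t \<and> grid_dist d C > int t \<or>
      grid_dist c (0, 0) \<ge> int t \<and> grid_dist d (0, 0) \<ge> int t + 2 \<or>
      grid_dist d (0, 0) \<ge> int t \<and> grid_dist c (0, 0) \<ge> int t + 2"
      using sum[OF in_grid(1)] sum[OF in_grid(2)] t by linarith
    then show ?thesis using stay corner[of c d] corner[of d c] cops by blast
  qed
qed

theorem corollary3:
  fixes m n :: nat
  assumes "m \<ge> 2" and "n \<ge> 2"
  shows "capture_time 2 (cartesian_product (path_graph m) (path_graph n)) =
    enat ((m + n) div 2 - 1)"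
proof -
  have "(m + n) div 2 - 1 \<le> t" if "cops_win_within 2 (grid m n) t" for t
  proof (rule ccontr)
    assume "\<not> ?thesis"
    then have "t \<le> (m + n) div 2 - 2" by simp
    then show False
      using that robber_evades_two_cops[OF assms] unfolding cops_win_within_def
      by (meson order_trans)
  qed
  then show ?thesis
    unfolding capture_time_def
    using two_cops_win_on_grid[OF assms] by (intro antisym INF_lower INF_greatest) auto
qed

end
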